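(* Let $B$ and $\widetilde{B}$ be bouquets and suppose there is a bijection $E(B)\to E(\widetilde{B})$ under which the intersection graphs $G_{D(B)}$ and $G_{D(\widetilde{B})}$ coincide. Then ${}^{\partial}\varepsilon_{B}(z)={}^{\partial}\varepsilon_{\widetilde{B}}(z)$.
   Context: A bouquet is a ribbon graph with exactly one vertex. For a ribbon graph $G$, $D(G)=(E(G),\mathcal{F})$ with $\mathcal{F}$ the edge sets of spanning quasi-trees of $G$ (spanning ribbon subgraphs with one boundary component per connected component); for a bouquet this delta-matroid is normal (contains $\emptyset$) and binary. $G^{A}$ is the partial dual of $G$ with respect to $A\subseteq E(G)$, $\varepsilon$ is Euler genus, and ${}^{\partial}\varepsilon_{G}(z)=\sum_{A\subseteq E(G)}z^{\varepsilon(G^{A})}$ is the partial duality polynomial. For a symmetric matrix $C$ over $GF(2)$ indexed by $E$, $D(C)=(E,\{A: C[A]\text{ nonsingular}\})$ with $C[\emptyset]$ nonsingular by convention; a normal binary delta-matroid $D$ equals $D(C)$ for a unique such $C$, and its intersection graph $G_D$ has vertex set $E$, distinct $u,v$ adjacent iff $C_{u,v}=1$, and a loop at $v$ iff $C_{v,v}=1$. *)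

theory Defs
  imports "HOL-Computational_Algebra.Polynomial"
begin

text \<open>A ribbon graph is encoded by its set of flags together with three
fixed-point-free involutions t0, t1, t2 (change vertex / change edge /
change face), where t0 and t2 commute and t0 t2 is fixed-point-free.
Vertices are the orbits of (t1,t2), edges the orbits of (t0,t2),
faces (boundary components) the orbits of (t0,t1), and connected
components the orbits of (t0,t1,t2).\<close>

record 'f gem =
  flags :: "'f set"
  t0 :: "'f \<Rightarrow> 'f"
  t1 :: "'f \<Rightarrow> 'f"
  t2 :: "'f \<Rightarrow> 'f"

definition fpf_inv :: "'f set \<Rightarrow> ('f \<Rightarrow> 'f) \<Rightarrow> bool" where
  "fpf_inv X t \<longleftrightarrow> (\<forall>x\<in>X. t x \<in> X \<and> t (t x) = x \<and> t x \<noteq> x)"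

definition wf_gem :: "'f gem \<Rightarrow> bool" where
  "wf_gem G \<longleftrightarrow> finite (flags G) \<and>
     fpf_inv (flags G) (t0 G) \<and> fpf_inv (flags G) (t1 G) \<and> fpf_inv (flags G) (t2 G) \<and>
     (\<forall>x\<in>flags G. t0 G (t2 G x) = t2 G (t0 G x) \<and> t0 G (t2 G x) \<noteq> x)"

definition gen_rel :: "'f set \<Rightarrow> ('f \<Rightarrow> 'f) set \<Rightarrow> ('f \<times> 'f) set" where
  "gen_rel X Ts = ({(x, t x) | x t. x \<in> X \<and> t \<in> Ts})\<^sup>*"

definition orbits :: "'f set \<Rightarrow> ('f \<Rightarrow> 'f) set \<Rightarrow> 'f set set" where
  "orbits X Ts = X // gen_rel X Ts"

definition vertices :: "'f gem \<Rightarrow> 'f set set" where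
  "vertices G = orbits (flags G) {t1 G, t2 G}"

definition edges :: "'f gem \<Rightarrow> 'f set set" where
  "edges G = orbits (flags G) {t0 G, t2 G}"

definition faces :: "'f gem \<Rightarrow> 'f set set" where
  "faces G = orbits (flags G) {t0 G, t1 G}"

definition components :: "'f gem \<Rightarrow> 'f set set" where
  "components G = orbits (flags G) {t0 G, t1 G, t2 G}"

definition euler_genus :: "'f gem \<Rightarrow> nat" where
  "euler_genus G = nat (2 * int (card (components G)) - int (card (vertices G))
                        + int (card (edges G)) - int (card (faces G)))"

definition partial_dual :: "'f gem \<Rightarrow> 'f set set \<Rightarrow> 'f gem" where
  "partial_dual G A =
     \<lparr> flags = flags G,
       t0 = (\<lambda>x. if x \<in> \<Union>A then t2 G x else t0 G x),
       t1 = t1 G,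
       t2 = (\<lambda>x. if x \<in> \<Union>A then t0 G x else t2 G x) \<rparr>"

definition pd_poly :: "'f gem \<Rightarrow> int poly" where
  "pd_poly G = (\<Sum>A\<in>Pow (edges G). monom 1 (euler_genus (partial_dual G A)))"

text \<open>A bouquet: a ribbon graph with exactly one vertex. The edgeless bouquet
(a single disc) has no flags and is represented by the empty gem.\<close>
definition is_bouquet :: "'f gem \<Rightarrow> bool" where
  "is_bouquet G \<longleftrightarrow> wf_gem G \<and> (flags G = {} \<or> card (vertices G) = 1)"

text \<open>Boundary components of the spanning ribbon subgraph (V(G), A): the
boundary runs along corners (t1), along the sides of edges in A (t0) and
passes over the ends of deleted edges at the vertex discs (t2).
Connected components of (V(G), A): generated by moving around vertices
(t1, t2) and across edges in A (t0 restricted to A).\<close>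
definition sub_boundaries :: "'f gem \<Rightarrow> 'f set set \<Rightarrow> 'f set set" where
  "sub_boundaries G A = orbits (flags G)
     {t1 G, (\<lambda>x. if x \<in> \<Union>A then t0 G x else t2 G x)}"

definition sub_components :: "'f gem \<Rightarrow> 'f set set \<Rightarrow> 'f set set" where
  "sub_components G A = orbits (flags G)
     {t1 G, t2 G, (\<lambda>x. if x \<in> \<Union>A then t0 G x else x)}"

definition spanning_quasi_tree :: "'f gem \<Rightarrow> 'f set set \<Rightarrow> bool" where
  "spanning_quasi_tree G A \<longleftrightarrow> A \<subseteq> edges G \<and>
     (\<forall>c\<in>sub_components G A. card {b\<in>sub_boundaries G A. b \<subseteq> c} = 1)"

definition DM :: "'f gem \<Rightarrow> 'f set set \<times> 'f set set set" where
  "DM G = (edges G, {A. spanning_quasi_tree G A})"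

text \<open>A matrix over GF(2) indexed by E is a map C :: 'e => 'e => bool
(True = 1). The principal submatrix C[A] is nonsingular iff its kernel is
trivial: the only X subset of A with C[A] * indicator(X) = 0 over GF(2)
is X = {}. In particular C[{}] is nonsingular.\<close>
definition nonsingular :: "('e \<Rightarrow> 'e \<Rightarrow> bool) \<Rightarrow> 'e set \<Rightarrow> bool" where
  "nonsingular C A \<longleftrightarrow>
     (\<forall>X\<subseteq>A. (\<forall>u\<in>A. even (card {v\<in>X. C u v})) \<longrightarrow> X = {})"

definition DM_of_matrix :: "'e set \<Rightarrow> ('e \<Rightarrow> 'e \<Rightarrow> bool) \<Rightarrow> 'e set \<times> 'e set set" where
  "DM_of_matrix E C = (E, {A. A \<subseteq> E \<and> nonsingular C A})"

definition rep_matrix :: "'e set \<times> 'e set set \<Rightarrow> ('e \<Rightarrow> 'e \<Rightarrow> bool)" where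
  "rep_matrix D = (THE C. (\<forall>u v. C u v \<longrightarrow> u \<in> fst D \<and> v \<in> fst D) \<and>
                          (\<forall>u v. C u v = C v u) \<and> DM_of_matrix (fst D) C = D)"

definition ig_adj :: "'e set \<times> 'e set set \<Rightarrow> 'e \<Rightarrow> 'e \<Rightarrow> bool" where
  "ig_adj D u v \<longleftrightarrow> u \<in> fst D \<and> v \<in> fst D \<and> u \<noteq> v \<and> rep_matrix D u v"

definition ig_loop :: "'e set \<times> 'e set set \<Rightarrow> 'e \<Rightarrow> bool" where
  "ig_loop D v \<longleftrightarrow> v \<in> fst D \<and> rep_matrix D v v"

end

theory Submission
  imports Defs
begin

text \<open>For a set \<open>A\<close> of edges of a bouquet let \<open>f A\<close> be the number of boundary components of the
  spanning ribbon subgraph on \<open>A\<close>. The partial dual with respect to \<open>A\<close> has \<open>f A\<close> vertices and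
  \<open>f (E - A)\<close> boundary components, so the partial duality polynomial depends only on \<open>f\<close>. Adding
  or removing one edge changes \<open>f\<close> by at most one, and if \<open>f A > 1\<close> then some edge decreases it;
  hence \<open>f A - 1\<close> is the distance from \<open>A\<close> to the nearest feasible set, and \<open>f\<close> is determined by
  the delta-matroid. That the intersection graph determines the delta-matroid is the statement
  that the latter is represented by the interlacement matrix of the chords: two-colourings of
  the boundary components of \<open>A\<close> correspond, up to a global swap, to the kernel of the principal
  submatrix on \<open>A\<close>.\<close>

section \<open>Orbits of involutions\<close>

definition orb :: "'f set \<Rightarrow> ('f \<Rightarrow> 'f) set \<Rightarrow> 'f \<Rightarrow> 'f set" where
  "orb X Ts x = gen_rel X Ts `` {x}"

text \<open>Fixed points are allowed because the third generator of \<open>sub_components\<close> is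
  the identity off the chosen edges.\<close>

definition invols :: "'f set \<Rightarrow> ('f \<Rightarrow> 'f) set \<Rightarrow> bool" where
  "invols X Ts \<longleftrightarrow> (\<forall>t\<in>Ts. \<forall>x\<in>X. t x \<in> X \<and> t (t x) = x)"

lemma orbits_eq_image_orb: "orbits X Ts = orb X Ts ` X"
  by (auto simp: orbits_def orb_def quotient_def)

lemma orb_self: "x \<in> orb X Ts x"
  by (simp add: orb_def gen_rel_def)

lemma orb_step:
  assumes "y \<in> orb X Ts x" "y \<in> X" "t \<in> Ts"
  shows "t y \<in> orb X Ts x"
proof -
  have "(y, t y) \<in> {(x, t x) | x t. x \<in> X \<and> t \<in> Ts}" using assms by auto
  then show ?thesis using assms(1) unfolding orb_def gen_rel_def
    by (auto intro: rtrancl_into_rtrancl)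
qed

lemma orb_minimal:
  assumes "x \<in> S" and step: "\<And>y t. y \<in> S \<Longrightarrow> y \<in> X \<Longrightarrow> t \<in> Ts \<Longrightarrow> t y \<in> S"
  shows "orb X Ts x \<subseteq> S"
proof
  fix y assume "y \<in> orb X Ts x"
  then have "(x, y) \<in> {(x, t x) | x t. x \<in> X \<and> t \<in> Ts}\<^sup>*"
    by (simp add: orb_def gen_rel_def)
  then show "y \<in> S" by (induction rule: rtrancl_induct) (use assms in auto)
qed

lemma orb_subset: "invols X Ts \<Longrightarrow> x \<in> X \<Longrightarrow> orb X Ts x \<subseteq> X"
  by (rule orb_minimal) (auto simp: invols_def)

lemma orb_mono:
  assumes "invols X Ts" "x \<in> X" "y \<in> orb X Ts x"
  shows "orb X Ts y \<subseteq> orb X Ts x"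
  using assms(3) by (rule orb_minimal) (rule orb_step)

text \<open>\<open>gen_rel\<close> is a reflexive transitive closure with no symmetry built in; each
  step is undone by repeating its involution.\<close>

lemma orb_sym:
  assumes "invols X Ts" "x \<in> X" "y \<in> orb X Ts x"
  shows "x \<in> orb X Ts y"
proof -
  have "orb X Ts x \<subseteq> {y \<in> X. x \<in> orb X Ts y}"
  proof (rule orb_minimal)
    show "x \<in> {y \<in> X. x \<in> orb X Ts y}" using assms orb_self by auto
  next
    fix y t assume y: "y \<in> {y \<in> X. x \<in> orb X Ts y}" "y \<in> X" "t \<in> Ts"
    then have ty: "t y \<in> X" "t (t y) = y" using assms(1) by (auto simp: invols_def)
    then have "y \<in> orb X Ts (t y)" using orb_step[OF orb_self ty(1) y(3)] by simp
    then have "orb X Ts y \<subseteq> orb X Ts (t y)" using orb_mono assms(1) ty(1) by metis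
    then show "t y \<in> {y \<in> X. x \<in> orb X Ts y}" using y ty by auto
  qed
  then show ?thesis using assms by auto
qed

lemma orb_eq:
  assumes "invols X Ts" "x \<in> X" "y \<in> orb X Ts x"
  shows "orb X Ts y = orb X Ts x"
proof
  show "orb X Ts y \<subseteq> orb X Ts x" using orb_mono assms by metis
  have "y \<in> X" using orb_subset[OF assms(1,2)] assms(3) by auto
  then show "orb X Ts x \<subseteq> orb X Ts y"
    using orb_mono[OF assms(1) _ orb_sym[OF assms]] by auto
qed

text \<open>Only the set of images of each point matters, so generators may be exchanged pointwise,
  as a partial dual exchanges \<open>t0\<close> and \<open>t2\<close> on the edges of
  \<open>A\<close>.\<close>

lemma orbits_cong:
  assumes "\<And>x. x \<in> X \<Longrightarrow> (\<lambda>t. t x) ` Ts = (\<lambda>t. t x) ` Ts'"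
  shows "orbits X Ts = orbits X Ts'"
proof -
  have "{(x, t x) | x t. x \<in> X \<and> t \<in> Us} = (\<Union>x\<in>X. {x} \<times> (\<lambda>t. t x) ` Us)" for Us :: "('a \<Rightarrow> 'a) set"
    by auto
  then have "gen_rel X Ts = gen_rel X Ts'" using assms by (simp add: gen_rel_def)
  then show ?thesis by (simp add: orbits_def)
qed

lemma card_orbits_eq_1_iff:
  assumes "invols X Ts" "x0 \<in> X"
  shows "card (orbits X Ts) = 1 \<longleftrightarrow> (\<forall>x\<in>X. orb X Ts x = X)"
proof
  assume "card (orbits X Ts) = 1"
  then obtain P where P: "orb X Ts ` X = {P}"
    unfolding orbits_eq_image_orb by (auto simp: card_1_singleton_iff)
  have "P = X"
  proof
    show "P \<subseteq> X" using P assms orb_subset[of X Ts] by fastforce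
    show "X \<subseteq> P" using P orb_self[of _ X Ts] by blast
  qed
  then show "\<forall>x\<in>X. orb X Ts x = X" using P by auto
next
  assume "\<forall>x\<in>X. orb X Ts x = X"
  then have "orb X Ts ` X = {X}" using assms(2) by auto
  then show "card (orbits X Ts) = 1" by (simp add: orbits_eq_image_orb)
qed

text \<open>Split off the pair \<open>{x, t x}\<close> and induct. This is the source of every
  parity argument about flags below.\<close>

lemma even_card_fpf_involution:
  assumes "finite S" "\<And>x. x \<in> S \<Longrightarrow> t x \<in> S" "\<And>x. x \<in> S \<Longrightarrow> t (t x) = x"
    "\<And>x. x \<in> S \<Longrightarrow> t x \<noteq> x"
  shows "even (card S)"
  using assms
proof (induction "card S" arbitrary: S rule: less_induct)
  case less
  show ?case
  proof (cases "S = {}")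
    case False
    then obtain x where x: "x \<in> S" by auto
    let ?S = "S - {x, t x}"
    have two: "card {x, t x} = 2" using less.prems(4)[OF x] by auto
    have sub: "{x, t x} \<subseteq> S" using x less.prems(2) by auto
    have c: "card S = card ?S + 2"
      using card_Diff_subset[of "{x, t x}" S] card_mono[OF less.prems(1) sub] two sub by auto
    have "even (card ?S)"
    proof (rule less.hyps)
      show "card ?S < card S" using c by simp
      fix y assume y: "y \<in> ?S"
      then show "t (t y) = y" "t y \<noteq> y" using less.prems by auto
      have "t y \<noteq> x" "t y \<noteq> t x" using y x less.prems(3) by (metis DiffD1 DiffD2 insertI1 insertI2)+
      then show "t y \<in> ?S" using y less.prems(2) by auto
    qed (use less.prems in auto)
    then show ?thesis using c by simp
  qed simp
qed

section \<open>Orbit counts when one involution is changed on a small set\<close>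

text \<open>An orbit that avoids \<open>D\<close> only sees points where \<open>b\<close> and
  \<open>b'\<close> agree. Exchanging their roles gives the other inclusion.\<close>

lemma orbits_avoiding_subset:
  assumes "invols X {a, b}" "invols X {a, b'}" "\<And>z. z \<in> X - D \<Longrightarrow> b z = b' z"
  shows "{P \<in> orbits X {a, b}. P \<inter> D = {}} \<subseteq> {P \<in> orbits X {a, b'}. P \<inter> D = {}}"
proof
  fix P assume "P \<in> {P \<in> orbits X {a, b}. P \<inter> D = {}}"
  then obtain x where x: "x \<in> X" "P = orb X {a, b} x" "P \<inter> D = {}"
    by (auto simp: orbits_eq_image_orb)
  have PX: "P \<subseteq> X" using x orb_subset[OF assms(1)] by auto
  have st: "t y \<in> P" if "y \<in> P" "t \<in> {a, b}" for y t
    using orb_step[of y X "{a, b}" x t] that x PX by auto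
  have 1: "orb X {a, b'} x \<subseteq> P"
  proof (rule orb_minimal)
    show "x \<in> P" using x orb_self by auto
    fix y t assume y: "y \<in> P" "y \<in> X" "t \<in> {a, b'}"
    then have "y \<in> X - D" using x by auto
    then have "b' y = b y" using assms(3) by auto
    then show "t y \<in> P" using y st[of y a] st[of y b] by auto
  qed
  have 2: "P \<subseteq> orb X {a, b'} x"
    unfolding x(2)
  proof (rule orb_minimal)
    show "x \<in> orb X {a, b'} x" by (rule orb_self)
    fix y t assume y: "y \<in> orb X {a, b'} x" "y \<in> X" "t \<in> {a, b}"
    then have "y \<in> X - D" using x 1 by auto
    then have "b' y = b y" using assms(3) by auto
    then show "t y \<in> orb X {a, b'} x"
      using y orb_step[of y X "{a, b'}" x a] orb_step[of y X "{a, b'}" x b'] by auto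
  qed
  have "P = orb X {a, b'} x" using 1 2 by auto
  then show "P \<in> {P \<in> orbits X {a, b'}. P \<inter> D = {}}" using x by (auto simp: orbits_eq_image_orb)
qed

text \<open>\<open>D\<close> consists of the \<open>b\<close>-pairs of \<open>x\<close> and
  \<open>y\<close>, so an orbit meeting \<open>D\<close> is that of \<open>x\<close> or of
  \<open>y\<close>. The last summand is 1 or 2 according to whether these coincide.\<close>

lemma card_orbits_split:
  assumes "finite X" "invols X {a, b}" "x \<in> X" "y \<in> X" "D = {x, b x, y, b y}"
  shows "card (orbits X {a, b}) =
    card {P \<in> orbits X {a, b}. P \<inter> D = {}} + card {orb X {a, b} x, orb X {a, b} y}"
proof -
  let ?r = "orb X {a, b}"
  have "{P \<in> orbits X {a, b}. P \<inter> D \<noteq> {}} = {?r x, ?r y}"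
  proof
    show "{?r x, ?r y} \<subseteq> {P \<in> orbits X {a, b}. P \<inter> D \<noteq> {}}"
      using assms orb_self[of x X "{a, b}"] orb_self[of y X "{a, b}"] by (auto simp: orbits_eq_image_orb)
    show "{P \<in> orbits X {a, b}. P \<inter> D \<noteq> {}} \<subseteq> {?r x, ?r y}"
    proof
      fix P assume "P \<in> {P \<in> orbits X {a, b}. P \<inter> D \<noteq> {}}"
      then obtain z w where z: "z \<in> X" "P = ?r z" "w \<in> P" "w \<in> D"
        by (auto simp: orbits_eq_image_orb)
      then have "?r w = P" using orb_eq[OF assms(2)] by auto
      moreover have "?r (b x) = ?r x" "?r (b y) = ?r y"
        using orb_eq[OF assms(2)] orb_step[OF orb_self] assms(3,4) by (metis insertCI)+
      ultimately show "P \<in> {?r x, ?r y}" using z(4) assms(5) by auto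
    qed
  qed
  moreover have "finite (orbits X {a, b})" using assms(1) by (simp add: orbits_eq_image_orb)
  moreover have "orbits X {a, b} = {P \<in> orbits X {a, b}. P \<inter> D = {}} \<union> {P \<in> orbits X {a, b}. P \<inter> D \<noteq> {}}"
    by auto
  moreover have "card ({P \<in> orbits X {a, b}. P \<inter> D = {}} \<union> {P \<in> orbits X {a, b}. P \<inter> D \<noteq> {}}) =
      card {P \<in> orbits X {a, b}. P \<inter> D = {}} + card {P \<in> orbits X {a, b}. P \<inter> D \<noteq> {}}"
    using calculation(2) by (intro card_Un_disjoint) auto
  ultimately show ?thesis by argo
qed

text \<open>On a cycle whose edges are alternately pairs of \<open>a\<close> and of \<open>b\<close>, crossing the two
  \<open>b\<close>-pairs that form \<open>D\<close> separates the cycle into two arcs; \<open>g\<close> is the indicator of one arc.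
  One direction of travel, the orbit \<open>O\<close> of \<open>\<rho> = a \<circ> b\<close>, meets every pair exactly once,
  and \<open>g\<close> counts the crossings made when travelling from a base point.\<close>

lemma exists_arc_indicator:
  assumes "finite X" and a: "fpf_inv X a" and b: "fpf_inv X b"
    and trans: "\<And>x. x \<in> X \<Longrightarrow> orb X {a, b} x = X"
    and D: "D \<subseteq> X" "\<And>x. x \<in> D \<Longrightarrow> b x \<in> D" "card D = 4"
  shows "\<exists>g :: 'f \<Rightarrow> bool. \<forall>x\<in>X. g (a x) = g x \<and> g (b x) = (g x \<noteq> (x \<in> D))"
proof -
  have aX: "a x \<in> X" "a (a x) = x" "a x \<noteq> x" if "x \<in> X" for x
    using a that by (auto simp: fpf_inv_def)
  have bX: "b x \<in> X" "b (b x) = x" "b x \<noteq> x" if "x \<in> X" for x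
    using b that by (auto simp: fpf_inv_def)
  obtain x0 where x0: "x0 \<in> X" using D(1,3) by fastforce
  \<comment> \<open>The identity off \<open>X\<close> makes \<open>\<rho>\<close> injective on the
    whole type, which yields its periodicity at \<open>x0\<close>.\<close>
  define \<rho> where "\<rho> x = (if x \<in> X then a (b x) else x)" for x
  have \<rho>X: "\<rho> x \<in> X" if "x \<in> X" for x using that aX bX by (simp add: \<rho>_def)
  have pX: "(\<rho> ^^ n) x \<in> X" if "x \<in> X" for n x using that \<rho>X by (induction n) auto
  have inj: "inj \<rho>"
  proof (rule injI)
    fix x y assume "\<rho> x = \<rho> y"
    then show "x = y" unfolding \<rho>_def
      using aX[of "b x"] aX[of "b y"] bX[of x] bX[of y] by (metis (full_types))
  qed
  have "finite {y. \<exists>n. y = (\<rho> ^^ n) x0}"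
    using pX x0 by (intro finite_subset[OF _ assms(1)]) auto
  then have ex: "\<exists>n>0. (\<rho> ^^ n) x0 = x0" using funpow_inj_finite[OF inj] by metis
  define N where "N = (LEAST n. n > 0 \<and> (\<rho> ^^ n) x0 = x0)"
  have N: "N > 0" "(\<rho> ^^ N) x0 = x0"
    using LeastI_ex[of "\<lambda>n. n > 0 \<and> (\<rho> ^^ n) x0 = x0"] ex unfolding N_def by auto
  have N_least: "(\<rho> ^^ n) x0 \<noteq> x0" if "0 < n" "n < N" for n
    using not_less_Least[of n "\<lambda>n. n > 0 \<and> (\<rho> ^^ n) x0 = x0"] that unfolding N_def by auto
  define p where "p n = (\<rho> ^^ n) x0" for n
  have p_mod: "p (n mod N) = p n" for n unfolding p_def by (rule funpow_mod_eq[OF N(2)])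
  have p_Suc: "p (Suc n) = \<rho> (p n)" for n by (simp add: p_def)
  have p_in: "p n \<in> X" for n unfolding p_def by (rule pX[OF x0])
  have p_ne: "p i \<noteq> p j" if "i < j" "j < N" for i j
  proof
    assume eq: "p i = p j"
    have "(\<rho> ^^ i) ((\<rho> ^^ (j - i)) x0) = (\<rho> ^^ i) x0"
      using eq that unfolding p_def by (metis comp_apply funpow_add le_add_diff_inverse less_imp_le)
    moreover have "inj (\<rho> ^^ i)" using inj by (rule inj_fn)
    ultimately have "(\<rho> ^^ (j - i)) x0 = x0" by (auto dest: injD)
    then show False using N_least[of "j - i"] that by auto
  qed
  have p_inj: "inj_on p {..<N}"
    by (rule linorder_inj_onI) (use p_ne in auto)
  define Q where "Q = p ` {..<N}"
  have pQ: "p n \<in> Q" for n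
    using p_mod[of n] N(1) unfolding Q_def by (metis imageI lessThan_iff mod_less_divisor)
  have QX: "Q \<subseteq> X" using p_in by (auto simp: Q_def)
  have Q_back: "\<exists>w\<in>Q. z = \<rho> w" if z: "z \<in> Q" for z
  proof -
    obtain i where i: "z = p i" using z by (auto simp: Q_def)
    have "p (Suc (i + (N - 1))) = p i"
      using p_mod[of "i + N"] p_mod[of i] N(1) by simp
    then show ?thesis using i p_Suc pQ by metis
  qed
  \<comment> \<open>Travel never returns in the opposite direction: such a return in
    \<open>n\<close> steps gives one in \<open>n - 2\<close> steps, and descent ends at a fixed
    point of \<open>a\<close> (\<open>n = 0\<close>) or of \<open>b\<close>
    (\<open>n = 1\<close>).\<close>
  have norefl: "(\<rho> ^^ n) y \<noteq> a y" if "y \<in> X" for n y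
    using that
  proof (induction n arbitrary: y rule: less_induct)
    case (less n)
    consider "n = 0" | "n = 1" | m where "n = Suc (Suc m)" by (metis One_nat_def not0_implies_Suc)
    then show ?case
    proof cases
      case 1
      then show ?thesis using aX[OF less.prems] by auto
    next
      case 2
      show ?thesis
      proof
        assume "(\<rho> ^^ n) y = a y"
        then have "a (b y) = a y" using 2 less.prems by (simp add: \<rho>_def)
        then have "a (a (b y)) = a (a y)" by simp
        then have "b y = y" using aX bX less.prems by auto
        then show False using bX less.prems by auto
      qed
    next
      case 3
      let ?y = "a (b y)"
      have y': "?y \<in> X" "\<rho> y = ?y" using less.prems aX bX by (auto simp: \<rho>_def)
      let ?z = "(\<rho> ^^ m) ?y"
      have z: "?z \<in> X" using pX y' by auto
      show ?thesis
      proof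
        assume "(\<rho> ^^ n) y = a y"
        then have "\<rho> ((\<rho> ^^ m) (\<rho> y)) = a y" using 3 by (simp add: funpow_swap1)
        then have "a (b ?z) = a y" using y' z by (simp add: \<rho>_def)
        then have "a (a (b ?z)) = a (a y)" by simp
        then have "b ?z = y" using aX bX less.prems z by auto
        then have "?z = b y" using bX z by metis
        then have "(\<rho> ^^ m) ?y = a ?y" using aX bX less.prems by auto
        then show False using less.IH[of m ?y] 3 y' by auto
      qed
    qed
  qed
  have Q_disj: "a y \<notin> Q" if y: "y \<in> Q" for y
  proof
    assume ay: "a y \<in> Q"
    have yX: "y \<in> X" using y QX by auto
    obtain i j where ij: "y = p i" "a y = p j" using y ay by (auto simp: Q_def)
    show False
    proof (cases "i \<le> j")
      case True
      then have "(\<rho> ^^ (j - i)) y = a y" using ij unfolding p_def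
        by (metis comp_apply funpow_add le_add_diff_inverse2)
      then show False using norefl yX by auto
    next
      case False
      then have "(\<rho> ^^ (i - j)) (a y) = y" using ij unfolding p_def
        by (metis comp_apply funpow_add le_add_diff_inverse2 nat_le_linear)
      then show False using norefl[of "a y" "i - j"] yX aX by auto
    qed
  qed
  have bQ: "b y \<notin> Q" if "y \<in> Q" for y
  proof -
    have "\<rho> y \<in> Q" using that p_Suc pQ unfolding Q_def by (metis imageE)
    moreover have "b y = a (\<rho> y)" using that QX aX bX by (auto simp: \<rho>_def)
    ultimately show ?thesis using Q_disj by auto
  qed
  have baQ: "b (a z) \<in> Q" if z: "z \<in> Q" for z
  proof -
    obtain w where w: "w \<in> Q" "z = \<rho> w" using Q_back[OF z] by auto
    then have "b (a z) = w" using QX aX bX by (auto simp: \<rho>_def)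
    then show ?thesis using w by simp
  qed
  have cover: "x \<in> Q \<or> a x \<in> Q" if "x \<in> X" for x
  proof -
    have "orb X {a, b} x0 \<subseteq> {x \<in> X. x \<in> Q \<or> a x \<in> Q}"
    proof (rule orb_minimal)
      show "x0 \<in> {x \<in> X. x \<in> Q \<or> a x \<in> Q}" using x0 pQ[of 0] by (auto simp: p_def)
      fix y t assume y: "y \<in> {x \<in> X. x \<in> Q \<or> a x \<in> Q}" "y \<in> X" "t \<in> {a, b}"
      have "b y \<in> Q \<or> a (b y) \<in> Q"
      proof (cases "y \<in> Q")
        case True
        then have "\<rho> y \<in> Q" using p_Suc pQ unfolding Q_def by (metis imageE)
        then show ?thesis using y by (simp add: \<rho>_def)
      next
        case False
        then have "a y \<in> Q" using y by auto
        then show ?thesis using baQ[of "a y"] aX y by auto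
      qed
      then show "t y \<in> {x \<in> X. x \<in> Q \<or> a x \<in> Q}" using y aX bX by auto
    qed
    then show ?thesis using trans[OF x0] that by auto
  qed
  have fD: "finite D" using D assms(1) finite_subset by auto
  \<comment> \<open>\<open>b\<close> reverses the direction of travel, so exactly two of the four
    flags of \<open>D\<close> lie on \<open>Q\<close>.\<close>
  have "bij_betw b (D \<inter> Q) (D - Q)"
  proof (rule bij_betw_byWitness[where f' = b])
    show "\<forall>x\<in>D \<inter> Q. b (b x) = x" "\<forall>x\<in>D - Q. b (b x) = x" using D bX by auto
    show "b ` (D \<inter> Q) \<subseteq> D - Q" using D bQ by auto
    show "b ` (D - Q) \<subseteq> D \<inter> Q"
    proof
      fix z assume "z \<in> b ` (D - Q)"
      then obtain y where y: "y \<in> D" "y \<notin> Q" "z = b y" by auto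
      then have "a y \<in> Q" "a (a y) = y" using cover D aX by auto
      then show "z \<in> D \<inter> Q" using baQ[of "a y"] y D by auto
    qed
  qed
  then have "card (D \<inter> Q) = card (D - Q)" by (rule bij_betw_same_card)
  moreover have "card D = card (D \<inter> Q) + card (D - Q)"
    using fD by (rule card_Int_Diff)
  ultimately have cDQ: "card (D \<inter> Q) = 2" using D(3) by simp
  \<comment> \<open>\<open>H n\<close> counts the crossings of \<open>D\<close> before step
    \<open>n\<close>. A full turn makes two, so the parity is the same at \<open>0\<close> and
    \<open>N\<close> and the indicator closes up.\<close>
  define H where "H n = card {i \<in> {..<n}. p i \<in> D}" for n
  have "D \<inter> Q = p ` {i \<in> {..<N}. p i \<in> D}" by (auto simp: Q_def)
  moreover have "inj_on p {i \<in> {..<N}. p i \<in> D}" using p_inj by (rule inj_on_subset) auto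
  ultimately have HN: "H N = 2" using cDQ card_image unfolding H_def by metis
  have H_Suc: "odd (H (Suc n)) = (odd (H n) \<noteq> (p n \<in> D))" for n
  proof -
    have "{i \<in> {..<Suc n}. p i \<in> D} = (if p n \<in> D then insert n {i \<in> {..<n}. p i \<in> D} else {i \<in> {..<n}. p i \<in> D})"
      by (auto simp: less_Suc_eq)
    then show ?thesis by (simp add: H_def)
  qed
  define h where "h y = odd (H (inv_into {..<N} p y))" for y
  have hp: "h (p n) = odd (H n)" if "n < N" for n
    using that p_inj by (simp add: h_def)
  have h_step: "h (\<rho> y) = (h y \<noteq> (y \<in> D))" if "y \<in> Q" for y
  proof -
    obtain n where n: "n < N" "y = p n" using \<open>y \<in> Q\<close> by (auto simp: Q_def)
    show ?thesis
    proof (cases "Suc n < N")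
      case True
      then show ?thesis using hp[of "Suc n"] hp[of n] n H_Suc p_Suc by auto
    next
      case False
      then have "Suc n = N" using n by simp
      then have "\<rho> y = p 0" "odd (H (Suc n)) = False" using n p_Suc[of n] N HN by (auto simp: p_def)
      moreover have "h (p 0) = False" using hp[of 0] N by (simp add: H_def)
      ultimately show ?thesis using n hp[of n] H_Suc[of n] by auto
    qed
  qed
  \<comment> \<open>Flags of the opposite direction receive the value of their
    \<open>a\<close>-partner on \<open>Q\<close>.\<close>
  define g where "g y = (if y \<in> Q then h y else h (a y))" for y
  have ga: "g (a x) = g x" if "x \<in> X" for x
    using that cover[of x] Q_disj[of x] Q_disj[of "a x"] aX[of x] by (auto simp: g_def)
  have gb1: "g (b x) = (g x \<noteq> (x \<in> D))" if "x \<in> Q" for x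
  proof -
    have "a (b x) = \<rho> x" using that QX by (auto simp: \<rho>_def)
    then show ?thesis using that bQ[of x] h_step[of x] by (auto simp: g_def)
  qed
  have gb: "g (b x) = (g x \<noteq> (x \<in> D))" if "x \<in> X" for x
  proof (cases "x \<in> Q")
    case False
    then have "a x \<in> Q" using cover that by auto
    then have bx: "b x \<in> Q" using baQ[of "a x"] aX that by auto
    have "b x \<in> D \<longleftrightarrow> x \<in> D" using D(2) bX[OF that] by metis
    then show ?thesis using gb1[OF bx] bX[OF that] by auto
  qed (rule gb1)
  show ?thesis using ga gb by auto
qed

section \<open>Gems with one vertex\<close>

definition toggle :: "'e \<Rightarrow> 'e set \<Rightarrow> 'e set" where
  "toggle e A = (if e \<in> A then A - {e} else insert e A)"

text \<open>On flags this is also the \<open>t2\<close> of the partial dual at \<open>A\<close>, so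
  the same orbits are boundary components of a subgraph and vertices of a partial dual.\<close>

definition side :: "'f gem \<Rightarrow> 'f set set \<Rightarrow> 'f \<Rightarrow> 'f" where
  "side G A x = (if x \<in> \<Union>A then t0 G x else t2 G x)"

definition boundary_count :: "'f gem \<Rightarrow> 'f set set \<Rightarrow> nat" where
  "boundary_count G A = card (orbits (flags G) {t1 G, side G A})"

text \<open>Stated as transitivity so that it holds for the edgeless bouquet, whose
  \<open>boundary_count\<close> is 0 because the empty gem has no orbits.\<close>

definition one_boundary :: "'f gem \<Rightarrow> 'f set set \<Rightarrow> bool" where
  "one_boundary G A \<longleftrightarrow> (\<forall>x\<in>flags G. orb (flags G) {t1 G, side G A} x = flags G)"

text \<open>The orbit form of the second assumption also admits the empty gem, which encodes the
  edgeless bouquet.\<close>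

locale one_vertex_gem =
  fixes G :: "'f gem"
  assumes wf: "wf_gem G"
    and one_vertex: "x \<in> flags G \<Longrightarrow> orb (flags G) {t1 G, t2 G} x = flags G"
begin

abbreviation "X \<equiv> flags G"

lemma finite_flags: "finite X" and fpf_t1: "fpf_inv X (t1 G)" and fpf_t2: "fpf_inv X (t2 G)"
  using wf by (auto simp: wf_gem_def)

lemma t_simps [simp]:
  assumes "x \<in> X"
  shows "t0 G x \<in> X" "t0 G (t0 G x) = x" "t0 G x \<noteq> x"
    "t1 G x \<in> X" "t1 G (t1 G x) = x" "t1 G x \<noteq> x"
    "t2 G x \<in> X" "t2 G (t2 G x) = x" "t2 G x \<noteq> x"
    "t2 G (t0 G x) = t0 G (t2 G x)" "t0 G (t2 G x) \<noteq> x"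
  using wf assms by (auto simp: wf_gem_def fpf_inv_def)

lemma t0_ne_t2 [simp]: "x \<in> X \<Longrightarrow> t0 G x \<noteq> t2 G x"
  by (metis t_simps(2,11))

lemma orb_edge:
  assumes "x \<in> X"
  shows "orb X {t0 G, t2 G} x = {x, t0 G x, t2 G x, t0 G (t2 G x)}"
proof
  show "orb X {t0 G, t2 G} x \<subseteq> {x, t0 G x, t2 G x, t0 G (t2 G x)}"
    by (rule orb_minimal) (use assms in auto)
  have "x \<in> orb X {t0 G, t2 G} x" by (rule orb_self)
  moreover have "t0 G x \<in> orb X {t0 G, t2 G} x" "t2 G x \<in> orb X {t0 G, t2 G} x"
    using orb_step[OF orb_self, of x X] assms by simp_all
  moreover have "t0 G (t2 G x) \<in> orb X {t0 G, t2 G} x"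
    using orb_step[OF calculation(3), of "t0 G"] assms by simp
  ultimately show "{x, t0 G x, t2 G x, t0 G (t2 G x)} \<subseteq> orb X {t0 G, t2 G} x" by simp
qed

lemma edges_eq: "edges G = (\<lambda>x. {x, t0 G x, t2 G x, t0 G (t2 G x)}) ` X"
  unfolding edges_def orbits_eq_image_orb by (rule image_cong) (auto simp: orb_edge)

lemma finite_edges: "finite (edges G)"
  using finite_flags by (simp add: edges_eq)

lemma edge_eq:
  assumes "e \<in> edges G" "x \<in> e"
  shows "e = {x, t0 G x, t2 G x, t0 G (t2 G x)}" "x \<in> X"
proof -
  obtain y where y: "y \<in> X" "e = {y, t0 G y, t2 G y, t0 G (t2 G y)}" using assms by (auto simp: edges_eq)
  then show "x \<in> X" using assms by auto
  show "e = {x, t0 G x, t2 G x, t0 G (t2 G x)}" using y assms(2) by auto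
qed

lemma edge_closed:
  assumes "e \<in> edges G" "x \<in> e"
  shows "t0 G x \<in> e" "t2 G x \<in> e"
  using edge_eq[OF assms] by auto

lemma edge_closed_iff:
  assumes "e \<in> edges G" "x \<in> X"
  shows "t0 G x \<in> e \<longleftrightarrow> x \<in> e" "t2 G x \<in> e \<longleftrightarrow> x \<in> e"
  using edge_closed[OF assms(1)] assms(2) t_simps(2,8) by metis+

lemma edge_unique:
  assumes "e \<in> edges G" "e' \<in> edges G" "x \<in> e" "x \<in> e'"
  shows "e = e'"
  using edge_eq[OF assms(1,3)] edge_eq[OF assms(2,4)] by simp

text \<open>The four flags are distinct because \<open>t0\<close>, \<open>t2\<close> and their
  product have no fixed points.\<close>

lemma card_edge: "e \<in> edges G \<Longrightarrow> card e = 4"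
proof -
  assume "e \<in> edges G"
  then obtain x where x: "x \<in> X" "e = {x, t0 G x, t2 G x, t0 G (t2 G x)}" by (auto simp: edges_eq)
  have "t0 G (t2 G x) \<noteq> t2 G x" "t2 G (t0 G x) \<noteq> t0 G x" using x t_simps(3,9) t_simps(1,7) by blast+
  then have "distinct [x, t0 G x, t2 G x, t0 G (t2 G x)]"
    using t_simps(3,9,10,11)[OF x(1), symmetric] t0_ne_t2[OF x(1)] x(1)
    by (simp only: distinct.simps list.set) (metis empty_iff insert_iff)
  then have "card (set [x, t0 G x, t2 G x, t0 G (t2 G x)]) = 4" by (simp only: distinct_card) simp
  then show ?thesis using x by simp
qed

lemma flag_in_edge: "x \<in> X \<Longrightarrow> \<exists>e\<in>edges G. x \<in> e"
  by (auto simp: edges_eq)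

lemma mem_Union_iff:
  "A \<subseteq> edges G \<Longrightarrow> e \<in> edges G \<Longrightarrow> x \<in> e \<Longrightarrow> x \<in> \<Union>A \<longleftrightarrow> e \<in> A"
  using edge_unique[of e] by auto

lemma side_on_edge:
  assumes "A \<subseteq> edges G" "e \<in> edges G" "x \<in> e"
  shows "side G A x = (if e \<in> A then t0 G x else t2 G x)"
  using mem_Union_iff[OF assms] by (simp add: side_def)

lemma side_closed:
  assumes "A \<subseteq> edges G" "e \<in> edges G" "x \<in> e"
  shows "side G A x \<in> e"
  using side_on_edge[OF assms] edge_closed[OF assms(2,3)] by simp

lemma side_simps:
  assumes "A \<subseteq> edges G" "x \<in> X"
  shows "side G A x \<in> X" "side G A (side G A x) = x" "side G A x \<noteq> x"
proof -
  obtain e where e: "e \<in> edges G" "x \<in> e" using flag_in_edge assms by blast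
  note se = side_on_edge[OF assms(1) e] side_on_edge[OF assms(1) e(1) side_closed[OF assms(1) e]]
  show "side G A x \<in> X" "side G A (side G A x) = x" "side G A x \<noteq> x"
    using se assms(2) by (auto split: if_splits)
qed

lemma invols_side: "A \<subseteq> edges G \<Longrightarrow> invols X {t1 G, side G A}"
  using side_simps by (auto simp: invols_def)

lemma orb_side_step:
  assumes "y \<in> orb X {t1 G, side G A} x" "y \<in> X"
  shows "t1 G y \<in> orb X {t1 G, side G A} x" "side G A y \<in> orb X {t1 G, side G A} x"
  using orb_step[OF assms, of "t1 G"] orb_step[OF assms, of "side G A"] by simp_all

lemma boundary_count_pos:
  assumes "X \<noteq> {}" shows "boundary_count G A > 0"
  using assms finite_flags by (simp add: boundary_count_def orbits_eq_image_orb card_gt_0_iff)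

lemma one_boundary_iff_count:
  assumes "A \<subseteq> edges G" "X \<noteq> {}"
  shows "one_boundary G A \<longleftrightarrow> boundary_count G A = 1"
proof -
  obtain x where "x \<in> X" using assms(2) by auto
  then show ?thesis using card_orbits_eq_1_iff[OF invols_side[OF assms(1)], of x]
    unfolding one_boundary_def boundary_count_def by simp
qed

lemma toggle_edges: "e \<in> edges G \<Longrightarrow> A \<subseteq> edges G \<Longrightarrow> toggle e A \<subseteq> edges G"
  by (auto simp: toggle_def)

section \<open>Effect of toggling one edge on the boundary count\<close>

lemma side_toggle_off:
  assumes "A \<subseteq> edges G" "e \<in> edges G" "x \<in> X - e"
  shows "side G (toggle e A) x = side G A x"
  using assms by (auto simp: side_def toggle_def)

lemma side_toggle_on:
  assumes "A \<subseteq> edges G" "e \<in> edges G" "x \<in> e"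
  shows "{side G A x, side G (toggle e A) x} = {t0 G x, t2 G x}"
    "side G A (side G (toggle e A) x) = t0 G (t2 G x)"
    "side G (toggle e A) (side G A x) = t0 G (t2 G x)"
proof -
  have x: "x \<in> X" using edge_eq assms by auto
  have "side G A y = (if e \<in> A then t0 G y else t2 G y)"
     "side G (toggle e A) y = (if e \<in> A then t2 G y else t0 G y)" if "y \<in> e" for y
    using side_on_edge[OF assms(1,2) that] side_on_edge[OF toggle_edges[OF assms(2,1)] assms(2) that]
    by (auto simp: toggle_def)
  then show "{side G A x, side G (toggle e A) x} = {t0 G x, t2 G x}"
    "side G A (side G (toggle e A) x) = t0 G (t2 G x)"
    "side G (toggle e A) (side G A x) = t0 G (t2 G x)"
    using edge_closed[OF assms(2,3)] assms(3) x by auto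
qed

text \<open>\<open>k\<close> counts the boundary components avoiding \<open>e\<close>, which are the
  same for \<open>A\<close> and \<open>A'\<close>. The two flags in each set represent the two pairs
  into which \<open>side\<close> divides the flags of \<open>e\<close>.\<close>

lemma boundary_count_toggle_split:
  assumes A: "A \<subseteq> edges G" and e: "e \<in> edges G" and x: "x \<in> e"
  defines "A' \<equiv> toggle e A"
  shows "\<exists>k. boundary_count G A =
      k + card {orb X {t1 G, side G A} x, orb X {t1 G, side G A} (side G A' x)} \<and>
    boundary_count G A' =
      k + card {orb X {t1 G, side G A'} x, orb X {t1 G, side G A'} (side G A x)}"
proof -
  have A': "A' \<subseteq> edges G" using toggle_edges[OF e A] by (simp add: A'_def)
  have xX: "x \<in> X" using edge_eq[OF e x] by simp
  note on = side_toggle_on[OF A e x, folded A'_def]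
  have "{side G A x, side G A' x, t0 G (t2 G x)} = {t0 G x, t2 G x, t0 G (t2 G x)}"
    using on(1) by auto
  then have e1: "e = {x, side G A x, side G A' x, side G A (side G A' x)}"
    and e2: "e = {x, side G A' x, side G A x, side G A' (side G A x)}"
    using edge_eq(1)[OF e x] on by auto
  have off: "side G A z = side G A' z" if "z \<in> X - e" for z
    using side_toggle_off[OF A e that] by (simp add: A'_def)
  have eq: "{P \<in> orbits X {t1 G, side G A}. P \<inter> e = {}} = {P \<in> orbits X {t1 G, side G A'}. P \<inter> e = {}}"
    using orbits_avoiding_subset[OF invols_side[OF A] invols_side[OF A'], of e]
      orbits_avoiding_subset[OF invols_side[OF A'] invols_side[OF A], of e] off by fastforce
  show ?thesis
    using card_orbits_split[OF finite_flags invols_side[OF A] xX side_simps(1)[OF A' xX] e1]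
      card_orbits_split[OF finite_flags invols_side[OF A'] xX side_simps(1)[OF A xX] e2] eq
    unfolding boundary_count_def by (intro exI[of _ "card {P \<in> orbits X {t1 G, side G A}. P \<inter> e = {}}"]) simp
qed

lemma boundary_count_toggle_le:
  assumes A: "A \<subseteq> edges G" and e: "e \<in> edges G"
  shows "boundary_count G A \<le> boundary_count G (toggle e A) + 1"
proof -
  obtain x where x: "x \<in> e" using card_edge[OF e] by fastforce
  have bounds: "card {P, Q} \<le> 2" "card {P, Q} \<ge> 1" for P Q :: "'f set"
    by (simp_all add: card_insert_if)
  obtain k and P Q P' Q' :: "'f set" where "boundary_count G A = k + card {P, Q}"
    "boundary_count G (toggle e A) = k + card {P', Q'}"
    using boundary_count_toggle_split[OF A e x] by blast
  then show ?thesis using bounds(1)[of P Q] bounds(2)[of P' Q'] by linarith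
qed

text \<open>Some edge must touch two boundary components, since the vertex is connected; toggling
  that edge merges them.\<close>

lemma exists_toggle_decreasing:
  assumes A: "A \<subseteq> edges G" and big: "boundary_count G A > 1"
  shows "\<exists>e\<in>edges G. boundary_count G (toggle e A) < boundary_count G A"
proof -
  let ?r = "orb X {t1 G, side G A}"
  have ne: "X \<noteq> {}" using big by (auto simp: boundary_count_def orbits_eq_image_orb)
  note inv = invols_side[OF A]
  \<comment> \<open>Otherwise every boundary component is closed under both \<open>t0\<close> and
    \<open>t2\<close>, hence contains a whole \<open>t1\<close>, \<open>t2\<close> orbit, which is
    all of \<open>X\<close>.\<close>
  have "\<exists>e x. e \<in> edges G \<and> x \<in> e \<and> side G (toggle e A) x \<notin> ?r x"
  proof (rule ccontr)
    assume no: "\<not> ?thesis"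
    have "?r x = X" if x: "x \<in> X" for x
    proof
      show "?r x \<subseteq> X" by (rule orb_subset[OF inv x])
      have "orb X {t1 G, t2 G} x \<subseteq> ?r x"
      proof (rule orb_minimal)
        show "x \<in> ?r x" by (rule orb_self)
        fix y t assume y: "y \<in> ?r x" "y \<in> X" "t \<in> {t1 G, t2 G}"
        obtain e where e: "e \<in> edges G" "y \<in> e" using flag_in_edge y by blast
        have "side G (toggle e A) y \<in> ?r x" using no e orb_mono[OF inv x y(1)] by blast
        moreover have "side G A y \<in> ?r x" "t1 G y \<in> ?r x" using orb_side_step[OF y(1,2)] by blast+
        moreover have "t2 G y \<in> {side G A y, side G (toggle e A) y}"
          unfolding side_toggle_on(1)[OF A e] by simp
        ultimately show "t y \<in> ?r x" using y(3) by auto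
      qed
      then show "X \<subseteq> ?r x" using one_vertex[OF x] by simp
    qed
    then have "boundary_count G A = 1"
      using one_boundary_iff_count[OF A ne] by (simp add: one_boundary_def)
    then show False using big by simp
  qed
  then obtain e x where e: "e \<in> edges G" and x: "x \<in> e" and out: "side G (toggle e A) x \<notin> ?r x" by auto
  let ?A = "toggle e A"
  let ?r' = "orb X {t1 G, side G ?A}"
  have A': "?A \<subseteq> edges G" using toggle_edges[OF e A] .
  have xX: "x \<in> X" using edge_eq[OF e x] by simp
  note inv' = invols_side[OF A']
  have "?r x \<noteq> ?r (side G ?A x)" using out orb_self[of "side G ?A x"] by auto
  then have two: "card {?r x, ?r (side G ?A x)} = 2" by simp
  \<comment> \<open>A flag set closed under both pairings off \<open>e\<close> meets \<open>e\<close> in an even number of flags.\<close>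
  have "side G A x \<in> ?r' x"
  proof (rule ccontr)
    assume nin: "side G A x \<notin> ?r' x"
    \<comment> \<open>If \<open>side G A x\<close> were not reached, this set would meet
      \<open>e\<close> in \<open>x\<close> alone, against the parity count.\<close>
    let ?S = "?r' x \<inter> ?r x"
    have SX: "?S \<subseteq> X" using orb_subset[OF inv xX] by auto
    have fin: "finite ?S" using finite_subset[OF SX finite_flags] .
    have st: "t1 G y \<in> ?S" if "y \<in> ?S" for y
      using that SX orb_side_step(1)[of y A x] orb_side_step(1)[of y ?A x] by blast
    have "even (card ?S)"
      by (rule even_card_fpf_involution[OF fin, of "t1 G"]) (use st SX t_simps(5,6) in blast)+
    moreover have "even (card (?S - e))"
    proof (rule even_card_fpf_involution[of _ "side G A"])
      fix y assume y: "y \<in> ?S - e"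
      then have yX: "y \<in> X - e" using SX by auto
      then show "side G A (side G A y) = y" "side G A y \<noteq> y" using side_simps[OF A, of y] by simp_all
      have "side G A y \<in> ?r x" using y yX orb_side_step(2)[of y A x] by blast
      moreover have "side G ?A y \<in> ?r' x" using y yX orb_side_step(2)[of y ?A x] by blast
      moreover have "side G A y \<notin> e"
        using side_closed[OF A e, of "side G A y"] side_simps(2)[OF A, of y] yX by (metis DiffE)
      ultimately show "side G A y \<in> ?S - e" using side_toggle_off[OF A e yX] by simp
    qed (use fin in simp)
    moreover have "?S \<inter> e = {x}"
    proof
      show "{x} \<subseteq> ?S \<inter> e" using x orb_self[of x] by simp
      have "e = {x} \<union> {t0 G x, t2 G x} \<union> {t0 G (t2 G x)}"
        using edge_eq(1)[OF e x] by auto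
      then have "e = {x} \<union> {side G A x, side G ?A x} \<union> {side G A (side G ?A x)}"
        using side_toggle_on(1,2)[OF A e x] by simp
      moreover have "side G A (side G ?A x) \<notin> ?r x"
      proof
        assume "side G A (side G ?A x) \<in> ?r x"
        then have "side G A (side G A (side G ?A x)) \<in> ?r x"
          using orb_side_step(2)[of "side G A (side G ?A x)" A x] side_simps(1)[OF A] side_simps(1)[OF A'] xX by blast
        then show False using out side_simps(2)[OF A side_simps(1)[OF A' xX]] by simp
      qed
      ultimately show "?S \<inter> e \<subseteq> {x}" using nin out by blast
    qed
    moreover have "card ?S = card (?S \<inter> e) + card (?S - e)"
      using fin by (rule card_Int_Diff)
    ultimately show False by simp
  qed
  then have "?r' (side G A x) = ?r' x" using orb_eq[OF inv' xX] by simp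
  then have "card {?r' x, ?r' (side G A x)} = 1" by simp
  then have "boundary_count G ?A < boundary_count G A"
    using boundary_count_toggle_split[OF A e x] two by auto
  then show ?thesis using e by auto
qed

end

section \<open>Interlacement and boundary components\<close>

text \<open>Cardinality modulo 2 is additive under symmetric difference.\<close>

lemma odd_card_neq:
  assumes "finite Y"
  shows "odd (card {v \<in> Y. P v \<noteq> Q v}) = (odd (card {v \<in> Y. P v}) \<noteq> odd (card {v \<in> Y. Q v}))"
  using assms
proof (induction Y)
  case (insert y Y)
  have "{v \<in> insert y Y. R v} = (if R y then insert y {v \<in> Y. R v} else {v \<in> Y. R v})" for R
    by auto
  then show ?case using insert by simp
qed simp

context one_vertex_gem
begin

text \<open>On \<open>X\<close> the indicator is determined up to complement.
  \<open>interlace\<close> compares two of its values, so it does not depend on the choice.\<close>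

definition arc :: "'f set \<Rightarrow> 'f \<Rightarrow> bool" where
  "arc v = (SOME g. \<forall>x\<in>X. g (t1 G x) = g x \<and> g (t2 G x) = (g x \<noteq> (x \<in> v)))"

lemma arc:
  assumes "v \<in> edges G" "x \<in> X"
  shows "arc v (t1 G x) = arc v x" "arc v (t2 G x) = (arc v x \<noteq> (x \<in> v))"
proof -
  have "\<exists>g. \<forall>x\<in>X. g (t1 G x) = g x \<and> g (t2 G x) = (g x \<noteq> (x \<in> v))"
  proof (rule exists_arc_indicator)
    show "v \<subseteq> X" using edge_eq assms(1) by blast
  qed (use finite_flags fpf_t1 fpf_t2 one_vertex edge_closed card_edge assms in simp_all)
  then have "\<forall>x\<in>X. arc v (t1 G x) = arc v x \<and> arc v (t2 G x) = (arc v x \<noteq> (x \<in> v))"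
    unfolding arc_def by (rule someI_ex)
  then show "arc v (t1 G x) = arc v x" "arc v (t2 G x) = (arc v x \<noteq> (x \<in> v))"
    using assms(2) by auto
qed

text \<open>The flags \<open>x\<close> and \<open>t0 G x\<close> lie on different ends of the edge \<open>u\<close>. For \<open>u \<noteq> v\<close> they are
  separated by \<open>v\<close> iff \<open>u\<close> and \<open>v\<close> are interlaced around the vertex; for \<open>u = v\<close> they are
  separated iff the loop \<open>u\<close> is twisted.\<close>

definition interlace :: "'f set \<Rightarrow> 'f set \<Rightarrow> bool" where
  "interlace u v \<longleftrightarrow> u \<in> edges G \<and> v \<in> edges G \<and> (\<exists>x\<in>u. arc v x \<noteq> arc v (t0 G x))"

text \<open>Passing from \<open>x\<close> to \<open>t2 G x\<close> changes the arc value at both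
  ends of \<open>u\<close> or at neither, so any flag of \<open>u\<close> may serve as
  representative.\<close>

lemma interlace_iff:
  assumes "u \<in> edges G" "v \<in> edges G" "x \<in> u"
  shows "interlace u v \<longleftrightarrow> arc v x \<noteq> arc v (t0 G x)"
proof -
  have xX: "x \<in> X" and u: "u = {x, t0 G x, t2 G x, t0 G (t2 G x)}" using edge_eq[OF assms(1,3)] by auto
  have "arc v (t2 G x) = (arc v x \<noteq> (x \<in> v))" by (rule arc(2)[OF assms(2) xX])
  moreover have "arc v (t0 G (t2 G x)) = (arc v (t0 G x) \<noteq> (x \<in> v))"
    using arc(2)[OF assms(2), of "t0 G x"] edge_closed_iff[OF assms(2)] xX by simp
  ultimately have "arc v y \<noteq> arc v (t0 G y) \<longleftrightarrow> arc v x \<noteq> arc v (t0 G x)" if "y \<in> u" for y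
    using that xX unfolding u by auto
  then show ?thesis using assms unfolding interlace_def by blast
qed

text \<open>Each end of \<open>u\<close> has exactly one flag in the arc of \<open>u\<close>, namely
  \<open>p\<close> and \<open>q\<close>, and \<open>arc v\<close> is constant on each end. The count
  is thus the number of ends of \<open>u\<close> inside the arc of \<open>v\<close>.\<close>

lemma odd_card_arc_edge:
  assumes "u \<in> edges G" "v \<in> edges G" "u \<noteq> v"
  shows "odd (card {x \<in> u. arc u x \<and> arc v x}) = interlace u v"
proof -
  obtain x where x: "x \<in> u" using card_edge[OF assms(1)] by fastforce
  have xX: "x \<in> X" and u: "u = {x, t0 G x, t2 G x, t0 G (t2 G x)}" using edge_eq[OF assms(1) x] by auto
  have nv: "y \<notin> v" if "y \<in> u" for y using edge_unique assms that by blast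
  have x0: "t0 G x \<in> u" "t0 G x \<in> X" using edge_closed[OF assms(1) x] xX by auto
  have 1: "arc v (t2 G x) = arc v x" "arc v (t0 G (t2 G x)) = arc v (t0 G x)"
    using arc(2)[OF assms(2) xX] arc(2)[OF assms(2) x0(2)] nv[OF x] nv[OF x0(1)] xX by auto
  have 2: "arc u (t2 G x) = (\<not> arc u x)" "arc u (t0 G (t2 G x)) = (\<not> arc u (t0 G x))"
    using arc(2)[OF assms(1) xX] arc(2)[OF assms(1) x0(2)] x x0 xX by auto
  define p where "p = (if arc u x then x else t2 G x)"
  define q where "q = (if arc u (t0 G x) then t0 G x else t0 G (t2 G x))"
  have "p \<noteq> q" unfolding p_def q_def
    using t_simps(1,3,7,9,11)[OF xX] t0_ne_t2[OF xX] t_simps(3)[OF t_simps(7)[OF xX]]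
      t_simps(9)[OF t_simps(1)[OF xX]] t_simps(10)[OF xX] by metis
  moreover have "{y \<in> u. arc u y} = {p, q}"
    unfolding p_def q_def using 2 by (subst u) auto
  then have "{y \<in> u. arc u y \<and> arc v y} = {y \<in> {p, q}. arc v y}" by auto
  moreover have "\<dots> = (if arc v x then {p} else {}) \<union> (if arc v (t0 G x) then {q} else {})"
    using 1 by (auto simp: p_def q_def)
  ultimately show ?thesis using interlace_iff[OF assms(1,2) x] by auto
qed

text \<open>The set of flags where both arcs hold is closed under \<open>t1\<close>, and outside \<open>u \<union> v\<close> under
  \<open>t2\<close>; so it has even size and meets \<open>u \<union> v\<close> in an even number of flags.\<close>

lemma interlace_sym: "interlace u v = interlace v u"
proof (cases "u \<in> edges G \<and> v \<in> edges G \<and> u \<noteq> v")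
  case True
  then have u: "u \<in> edges G" and v: "v \<in> edges G" and ne: "u \<noteq> v" by auto
  let ?S = "{x \<in> X. arc u x \<and> arc v x}"
  have fin: "finite ?S" using finite_flags by simp
  have uX: "u \<subseteq> X" "v \<subseteq> X" using edge_eq u v by blast+
  have "even (card ?S)"
    by (rule even_card_fpf_involution[OF fin, of "t1 G"]) (use arc u v in auto)
  moreover have "even (card (?S - (u \<union> v)))"
  proof (rule even_card_fpf_involution[of _ "t2 G"])
    fix x assume "x \<in> ?S - (u \<union> v)"
    then show "t2 G x \<in> ?S - (u \<union> v)" using arc(2) edge_closed_iff(2) u v by auto
  qed (use fin in auto)
  moreover have "card ?S = card (?S \<inter> (u \<union> v)) + card (?S - (u \<union> v))"
    using fin by (rule card_Int_Diff)
  ultimately have "even (card (?S \<inter> (u \<union> v)))" by simp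
  moreover have "?S \<inter> (u \<union> v) = {x \<in> u. arc u x \<and> arc v x} \<union> {x \<in> v. arc v x \<and> arc u x}"
    using uX by auto
  moreover have "u \<inter> v = {}" using edge_unique u v ne by blast
  then have "{x \<in> u. arc u x \<and> arc v x} \<inter> {x \<in> v. arc v x \<and> arc u x} = {}" by auto
  moreover have "finite u" "finite v" using uX finite_flags finite_subset by metis+
  ultimately have "even (card {x \<in> u. arc u x \<and> arc v x} + card {x \<in> v. arc v x \<and> arc u x})"
    by (simp add: card_Un_disjoint)
  then show ?thesis
    using odd_card_arc_edge[OF u v ne] odd_card_arc_edge[OF v u] ne by auto
qed (auto simp: interlace_def)

definition arc_sum :: "'f set set \<Rightarrow> 'f \<Rightarrow> bool" where
  "arc_sum Y x = odd (card {v \<in> Y. arc v x})"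

text \<open>Linearity over GF(2), together with disjointness of edges. The last clause reads row
  \<open>u\<close> of \<open>interlace\<close> applied to \<open>Y\<close> as the colour difference
  between the ends of \<open>u\<close>.\<close>

lemma arc_sum:
  assumes Y: "Y \<subseteq> edges G" and x: "x \<in> X"
  shows "arc_sum Y (t1 G x) = arc_sum Y x"
    and "arc_sum Y (t2 G x) = (arc_sum Y x \<noteq> (x \<in> \<Union>Y))"
    and "u \<in> edges G \<Longrightarrow> x \<in> u \<Longrightarrow>
      odd (card {v \<in> Y. interlace u v}) = (arc_sum Y x \<noteq> arc_sum Y (t0 G x))"
proof -
  have fin: "finite Y" using Y finite_edges finite_subset by auto
  have "{v \<in> Y. arc v (t1 G x)} = {v \<in> Y. arc v x}" using arc(1) Y x by blast
  then show "arc_sum Y (t1 G x) = arc_sum Y x" by (simp add: arc_sum_def)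
  have 1: "{v \<in> Y. arc v (t2 G x)} = {v \<in> Y. arc v x \<noteq> (x \<in> v)}" using arc(2) Y x by blast
  have 2: "odd (card {v \<in> Y. x \<in> v}) = (x \<in> \<Union>Y)"
  proof (cases "x \<in> \<Union>Y")
    case True
    then obtain e where "e \<in> Y" "x \<in> e" by auto
    then have "{v \<in> Y. x \<in> v} = {e}" using edge_unique Y by blast
    then show ?thesis using True by simp
  next
    case False
    then have none: "{v \<in> Y. x \<in> v} = {}" by auto
    show ?thesis unfolding none using False by simp
  qed
  show "arc_sum Y (t2 G x) = (arc_sum Y x \<noteq> (x \<in> \<Union>Y))"
    unfolding arc_sum_def 1 odd_card_neq[OF fin] 2 ..
  assume "u \<in> edges G" "x \<in> u"
  then have "{v \<in> Y. interlace u v} = {v \<in> Y. arc v x \<noteq> arc v (t0 G x)}"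
    using interlace_iff Y by blast
  then show "odd (card {v \<in> Y. interlace u v}) = (arc_sum Y x \<noteq> arc_sum Y (t0 G x))"
    unfolding arc_sum_def by (simp only: odd_card_neq[OF fin])
qed

text \<open>Sums of arcs over \<open>Y\<close> correspond to two-colourings of the flags that change across \<open>t2\<close>
  exactly on \<open>Y\<close>; \<open>Y\<close> is in the kernel of \<open>interlace[A]\<close> iff the colouring is constant on
  boundary components.\<close>

lemma nonsingular_iff_one_boundary:
  assumes A: "A \<subseteq> edges G"
  shows "nonsingular interlace A \<longleftrightarrow> one_boundary G A"
proof
  assume ns: "nonsingular interlace A"
  show "one_boundary G A"
    unfolding one_boundary_def
  proof
    fix x0 assume x0: "x0 \<in> X"
    let ?P = "orb X {t1 G, side G A} x0"
    have PX: "?P \<subseteq> X" by (rule orb_subset[OF invols_side[OF A] x0])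
    have P1: "t1 G x \<in> ?P \<longleftrightarrow> x \<in> ?P" if "x \<in> X" for x
      using orb_side_step(1)[of x A x0] orb_side_step(1)[of "t1 G x" A x0] that by auto
    have Ps: "side G A x \<in> ?P \<longleftrightarrow> x \<in> ?P" if "x \<in> X" for x
      using orb_side_step(2)[of x A x0] orb_side_step(2)[of "side G A x" A x0] side_simps[OF A that] that
      by metis
    \<comment> \<open>The kernel candidate: the edges of \<open>A\<close> along which the indicator
      of \<open>?P\<close> changes across \<open>t2\<close>. Off \<open>A\<close> there is no
      change, since \<open>side\<close> is \<open>t2\<close> there.\<close>
    define Y where "Y = {e \<in> A. \<exists>x\<in>e. (x \<in> ?P) \<noteq> (t2 G x \<in> ?P)}"
    have YA: "Y \<subseteq> A" and YE: "Y \<subseteq> edges G" using A by (auto simp: Y_def)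
    have P0: "t0 G x \<in> ?P \<longleftrightarrow> x \<in> ?P" if "e \<in> A" "x \<in> e" for e x
      using Ps[of x] side_on_edge[OF A _ that(2)] edge_eq(2)[OF _ that(2)] that A by auto
    have P2: "t2 G x \<in> ?P \<longleftrightarrow> (x \<in> ?P) \<noteq> (x \<in> \<Union>Y)" if x: "x \<in> X" for x
    proof -
      obtain e where e: "e \<in> edges G" "x \<in> e" using flag_in_edge x by blast
      show ?thesis
      proof (cases "e \<in> A")
        case False
        then have "side G A x = t2 G x" using side_on_edge[OF A e] by simp
        moreover have "x \<notin> \<Union>Y" using False mem_Union_iff[OF YE e] YA by auto
        ultimately show ?thesis using Ps[OF x] by simp
      next
        case True
        have e4: "e = {x, t0 G x, t2 G x, t0 G (t2 G x)}" by (rule edge_eq(1)[OF e])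
        have a: "t0 G x \<in> ?P \<longleftrightarrow> x \<in> ?P" using P0[OF True e(2)] .
        have b: "t0 G (t2 G x) \<in> ?P \<longleftrightarrow> t2 G x \<in> ?P" using P0[OF True edge_closed(2)[OF e]] .
        have "(y \<in> ?P) \<noteq> (t2 G y \<in> ?P) \<longleftrightarrow> (x \<in> ?P) \<noteq> (t2 G x \<in> ?P)" if "y \<in> e" for y
          using that a b x unfolding e4 by auto
        then have "e \<in> Y \<longleftrightarrow> (x \<in> ?P) \<noteq> (t2 G x \<in> ?P)" using True e(2) unfolding Y_def by blast
        then show ?thesis using mem_Union_iff[OF YE e] by auto
      qed
    qed
    \<comment> \<open>\<open>arc_sum Y\<close> and the indicator of \<open>?P\<close> jump at the
      same places, so around the single vertex they agree everywhere or differ everywhere.\<close>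
    have "X \<subseteq> {x \<in> X. arc_sum Y x = (x \<in> ?P) \<longleftrightarrow> arc_sum Y x0 = (x0 \<in> ?P)}" (is "_ \<subseteq> ?W")
    proof -
      have "orb X {t1 G, t2 G} x0 \<subseteq> ?W"
      proof (rule orb_minimal)
        show "x0 \<in> ?W" using x0 by simp
        fix y t assume y: "y \<in> ?W" "y \<in> X" "t \<in> {t1 G, t2 G}"
        have "t1 G y \<in> ?W" using y(1) arc_sum(1)[OF YE y(2)] P1[OF y(2)] y(2) by simp
        moreover have "t2 G y \<in> ?W" using y(1) arc_sum(2)[OF YE y(2)] P2[OF y(2)] y(2) by auto
        ultimately show "t y \<in> ?W" using y(3) by blast
      qed
      then show ?thesis using one_vertex[OF x0] by simp
    qed
    then have W: "arc_sum Y x = (x \<in> ?P) \<longleftrightarrow> arc_sum Y x0 = (x0 \<in> ?P)" if "x \<in> X" for x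
      using that by blast
    have "even (card {v \<in> Y. interlace u v})" if u: "u \<in> A" for u
    proof -
      have uE: "u \<in> edges G" using u A by auto
      obtain x where x: "x \<in> u" using card_edge[OF uE] by fastforce
      have xX: "x \<in> X" "t0 G x \<in> X" using edge_eq(2)[OF uE x] by auto
      have "arc_sum Y x = arc_sum Y (t0 G x)" using W[OF xX(1)] W[OF xX(2)] P0[OF u x] by auto
      then show ?thesis using arc_sum(3)[OF YE xX(1) uE x] by simp
    qed
    then have Y0: "Y = {}" using ns YA unfolding nonsingular_def by blast
    have "orb X {t1 G, t2 G} x0 \<subseteq> ?P"
    proof (rule orb_minimal)
      show "x0 \<in> ?P" by (rule orb_self)
      fix y t assume y: "y \<in> ?P" "y \<in> X" "t \<in> {t1 G, t2 G}"
      have "t1 G y \<in> ?P" "t2 G y \<in> ?P" using P1[OF y(2)] P2[OF y(2)] Y0 y(1) by auto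
      then show "t y \<in> ?P" using y(3) by blast
    qed
    then show "?P = X" using PX one_vertex[OF x0] by simp
  qed
next
  assume one: "one_boundary G A"
  show "nonsingular interlace A"
    unfolding nonsingular_def
  proof (intro allI impI)
    fix Y assume YA: "Y \<subseteq> A" and ker: "\<forall>u\<in>A. even (card {v \<in> Y. interlace u v})"
    have YE: "Y \<subseteq> edges G" using YA A by auto
    show "Y = {}"
    proof (rule ccontr)
      assume "Y \<noteq> {}"
      then obtain e where e: "e \<in> Y" "e \<in> edges G" using YE by auto
      then obtain x0 where x0: "x0 \<in> e" using card_edge[of e] by fastforce
      then have x0X: "x0 \<in> X" using edge_eq e by auto
      have "orb X {t1 G, side G A} x0 \<subseteq> {x \<in> X. arc_sum Y x = arc_sum Y x0}"
      proof (rule orb_minimal)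
        show "x0 \<in> {x \<in> X. arc_sum Y x = arc_sum Y x0}" using x0X by simp
        fix y t assume y: "y \<in> {x \<in> X. arc_sum Y x = arc_sum Y x0}" "y \<in> X" "t \<in> {t1 G, side G A}"
        obtain u where u: "u \<in> edges G" "y \<in> u" using flag_in_edge y(2) by blast
        have "arc_sum Y (side G A y) = arc_sum Y y"
        proof (cases "u \<in> A")
          case True
          then have "arc_sum Y y = arc_sum Y (t0 G y)" using ker arc_sum(3)[OF YE y(2) u] by auto
          then show ?thesis using side_on_edge[OF A u] True by simp
        next
          case False
          then have "y \<notin> \<Union>Y" using mem_Union_iff[OF YE u] YA by auto
          then show ?thesis using side_on_edge[OF A u] False arc_sum(2)[OF YE y(2)] by simp
        qed
        then have "side G A y \<in> {x \<in> X. arc_sum Y x = arc_sum Y x0}"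
          "t1 G y \<in> {x \<in> X. arc_sum Y x = arc_sum Y x0}"
          using y(1) side_simps(1)[OF A y(2)] arc_sum(1)[OF YE y(2)] y(2) by simp_all
        then show "t y \<in> {x \<in> X. arc_sum Y x = arc_sum Y x0}" using y(3) by blast
      qed
      then have "X \<subseteq> {x \<in> X. arc_sum Y x = arc_sum Y x0}" using one x0X by (simp add: one_boundary_def)
      \<comment> \<open>The colouring is constant on \<open>X\<close>, yet it must change across
        \<open>t2\<close> on the edge \<open>e\<close> of \<open>Y\<close>.\<close>
      then have "arc_sum Y (t2 G x0) = arc_sum Y x0" using t_simps(7)[OF x0X] by blast
      moreover have "x0 \<in> \<Union>Y" using e x0 by auto
      ultimately show False using arc_sum(2)[OF YE x0X] by blast
    qed
  qed
qed

end

section \<open>Binary delta-matroids\<close>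

lemma nonsingular_singleton: "nonsingular C {u} \<longleftrightarrow> C u u"
proof -
  have "{v \<in> {u}. C u v} = (if C u u then {u} else {})" by auto
  then show ?thesis unfolding nonsingular_def subset_singleton_iff by auto
qed

text \<open>Over GF(2) the determinant is \<open>C u u\<close> times \<open>C v v\<close> plus
  \<open>C u v\<close>, as squaring is trivial.\<close>

lemma nonsingular_pair:
  assumes "u \<noteq> v" and sym: "C v u = C u v"
  shows "nonsingular C {u, v} \<longleftrightarrow> C u v \<noteq> (C u u \<and> C v v)"
proof -
  have "Y \<subseteq> {u, v} \<longleftrightarrow> Y \<in> {{}, {u}, {v}, {u, v}}" for Y
    using Pow_insert[of u "{v}"] by auto
  then have sub: "(\<forall>Y\<subseteq>{u, v}. P Y) \<longleftrightarrow> P {} \<and> P {u} \<and> P {v} \<and> P {u, v}" for P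
    by (metis insert_iff empty_iff)
  have 1: "{w \<in> {a}. C x w} = (if C x a then {a} else {})" for a x by auto
  have 2: "{w \<in> {u, v}. C x w} = (if C x u then {u} else {}) \<union> (if C x v then {v} else {})" for x by auto
  show ?thesis unfolding nonsingular_def sub 1 2 using assms by auto
qed

text \<open>Singletons give the diagonal, and pairs then give the other entries. This is the
  uniqueness behind \<open>rep_matrix\<close>.\<close>

lemma matrix_determined_by_DM:
  assumes "DM_of_matrix E C = DM_of_matrix E C'"
    and "\<And>u v. C u v = C v u" "\<And>u v. C' u v = C' v u"
    and "u \<in> E" "v \<in> E"
  shows "C u v = C' u v"
proof -
  have ns: "nonsingular C A = nonsingular C' A" if "A \<subseteq> E" for A
    using assms(1) that by (auto simp: DM_of_matrix_def set_eq_iff)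
  have d: "C w w = C' w w" if "w \<in> E" for w
    using ns[of "{w}"] that by (simp add: nonsingular_singleton)
  show ?thesis
  proof (cases "u = v")
    case False
    then show ?thesis
      using ns[of "{u, v}"] d[OF assms(4)] d[OF assms(5)] assms(2)[of v u] assms(3)[of v u] assms(4,5)
      by (simp add: nonsingular_pair) blast
  qed (use d assms in simp)
qed

lemma nonsingular_image:
  assumes "inj_on \<phi> A" and "\<And>u v. u \<in> A \<Longrightarrow> v \<in> A \<Longrightarrow> C' (\<phi> u) (\<phi> v) = C u v"
  shows "nonsingular C' (\<phi> ` A) = nonsingular C A"
proof -
  have "card {w \<in> \<phi> ` Y. C' (\<phi> u) w} = card {v \<in> Y. C u v}" if "Y \<subseteq> A" "u \<in> A" for Y u
  proof -
    have "{w \<in> \<phi> ` Y. C' (\<phi> u) w} = \<phi> ` {v \<in> Y. C u v}" using assms(2) that by blast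
    moreover have "inj_on \<phi> {v \<in> Y. C u v}" using assms(1) that by (auto intro: inj_on_subset)
    ultimately show ?thesis by (simp add: card_image)
  qed
  then show ?thesis unfolding nonsingular_def all_subset_image by auto
qed

section \<open>Genus of partial duals\<close>

context one_vertex_gem
begin

text \<open>With one vertex every spanning subgraph is connected, so a single component has to be
  tested; on the empty gem both conditions are vacuous.\<close>

lemma spanning_quasi_tree_iff:
  "spanning_quasi_tree G A \<longleftrightarrow> A \<subseteq> edges G \<and> one_boundary G A"
proof (cases "A \<subseteq> edges G")
  case A: True
  let ?h = "\<lambda>x. if x \<in> \<Union>A then t0 G x else x"
  have "t0 G x \<in> \<Union>A" if "x \<in> \<Union>A" for x using that A edge_closed(1) by blast
  then have inv: "invols X {t1 G, t2 G, ?h}" by (auto simp: invols_def)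
  have "orb X {t1 G, t2 G, ?h} x = X" if x: "x \<in> X" for x
  proof
    show "orb X {t1 G, t2 G, ?h} x \<subseteq> X" by (rule orb_subset[OF inv x])
    have "orb X {t1 G, t2 G} x \<subseteq> orb X {t1 G, t2 G, ?h} x"
      by (rule orb_minimal[OF orb_self]) (erule (1) orb_step, auto)
    then show "X \<subseteq> orb X {t1 G, t2 G, ?h} x" using one_vertex[OF x] by simp
  qed
  then have comps: "sub_components G A = (\<lambda>x. X) ` X"
    unfolding sub_components_def orbits_eq_image_orb by (rule image_cong[OF refl])
  have side: "(\<lambda>x. if x \<in> \<Union>A then t0 G x else t2 G x) = side G A" by (simp add: fun_eq_iff side_def)
  have "{b \<in> sub_boundaries G A. b \<subseteq> X} = orbits X {t1 G, side G A}"
    unfolding sub_boundaries_def side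
    using orb_subset[OF invols_side[OF A]] by (auto simp: orbits_eq_image_orb)
  then have "spanning_quasi_tree G A \<longleftrightarrow> (X \<noteq> {} \<longrightarrow> boundary_count G A = 1)"
    using A by (auto simp: spanning_quasi_tree_def comps boundary_count_def)
  then show ?thesis using one_boundary_iff_count[OF A] A by (auto simp: one_boundary_def)
qed (simp add: spanning_quasi_tree_def)

text \<open>Links the abstract intersection graph to the chords: existence is
  \<open>nonsingular_iff_one_boundary\<close>, and the support condition fixes the entries outside
  \<open>edges G\<close>.\<close>

lemma rep_matrix_DM: "rep_matrix (DM G) = interlace"
proof -
  have fst: "fst (DM G) = edges G" by (simp add: DM_def)
  have eq: "DM_of_matrix (edges G) interlace = DM G"
    using nonsingular_iff_one_boundary by (auto simp: DM_of_matrix_def DM_def spanning_quasi_tree_iff)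
  show ?thesis
    unfolding rep_matrix_def fst
  proof (rule the_equality)
    show "(\<forall>u v. interlace u v \<longrightarrow> u \<in> edges G \<and> v \<in> edges G) \<and>
        (\<forall>u v. interlace u v = interlace v u) \<and> DM_of_matrix (edges G) interlace = DM G"
      using eq interlace_sym by (auto simp: interlace_def)
  next
    fix C assume C: "(\<forall>u v. C u v \<longrightarrow> u \<in> edges G \<and> v \<in> edges G) \<and>
        (\<forall>u v. C u v = C v u) \<and> DM_of_matrix (edges G) C = DM G"
    have "C u v = interlace u v" if "u \<in> edges G" "v \<in> edges G" for u v
      by (rule matrix_determined_by_DM[where E = "edges G"]) (use C eq interlace_sym that in auto)
    then show "C = interlace" using C unfolding fun_eq_iff interlace_def by blast
  qed
qed

text \<open>Exchanging \<open>t0\<close> and \<open>t2\<close> on \<open>A\<close> keeps edges and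
  the single component; vertices become the boundaries of \<open>A\<close>, and faces those of its
  complement.\<close>

lemma euler_genus_partial_dual:
  assumes A: "A \<subseteq> edges G" and ne: "X \<noteq> {}"
  shows "euler_genus (partial_dual G A) =
    nat (2 - int (boundary_count G A) + int (card (edges G)) - int (boundary_count G (edges G - A)))"
proof -
  let ?s0 = "\<lambda>x. if x \<in> \<Union>A then t2 G x else t0 G x"
  let ?s2 = "\<lambda>x. if x \<in> \<Union>A then t0 G x else t2 G x"
  let ?D = "partial_dual G A"
  have side: "?s2 = side G A" by (simp add: fun_eq_iff side_def)
  have co: "?s0 x = side G (edges G - A) x" if x: "x \<in> X" for x
  proof -
    obtain e where e: "e \<in> edges G" "x \<in> e" using flag_in_edge[OF x] by blast
    then show ?thesis using side_on_edge[of "edges G - A", OF _ e] mem_Union_iff[OF A e] by auto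
  qed
  have "vertices ?D = orbits X {t1 G, side G A}"
    unfolding vertices_def partial_dual_def by (simp only: gem.simps side)
  then have v: "card (vertices ?D) = boundary_count G A" by (simp add: boundary_count_def)
  have "faces ?D = orbits X {?s0, t1 G}" by (simp add: faces_def partial_dual_def)
  also have "\<dots> = orbits X {t1 G, side G (edges G - A)}"
    by (rule orbits_cong) (simp only: co image_insert image_empty insert_commute)
  finally have f: "card (faces ?D) = boundary_count G (edges G - A)" by (simp add: boundary_count_def)
  have "edges ?D = orbits X {?s0, ?s2}" by (simp add: edges_def partial_dual_def)
  also have "\<dots> = edges G" unfolding edges_def by (rule orbits_cong) auto
  finally have e: "edges ?D = edges G" .
  have "components ?D = orbits X {?s0, t1 G, ?s2}" by (simp add: components_def partial_dual_def)
  also have "\<dots> = orbits X {t0 G, t1 G, t2 G}" by (rule orbits_cong) auto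
  also have "\<dots> = {X}"
  proof -
    have inv: "invols X {t0 G, t1 G, t2 G}" by (auto simp: invols_def)
    have "orb X {t0 G, t1 G, t2 G} x = X" if x: "x \<in> X" for x
    proof
      show "orb X {t0 G, t1 G, t2 G} x \<subseteq> X" by (rule orb_subset[OF inv x])
      have "orb X {t1 G, t2 G} x \<subseteq> orb X {t0 G, t1 G, t2 G} x"
        by (rule orb_minimal[OF orb_self]) (erule (1) orb_step, auto)
      then show "X \<subseteq> orb X {t0 G, t1 G, t2 G} x" using one_vertex[OF x] by simp
    qed
    then show ?thesis using ne by (auto simp: orbits_eq_image_orb)
  qed
  finally have "card (components ?D) = 1" by simp
  then show ?thesis by (simp add: euler_genus_def v f e)
qed

end

section \<open>Transfer of boundary counts between two bouquets\<close>

lemma image_toggle: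
  assumes "inj_on \<phi> E" "A \<subseteq> E" "e \<in> E"
  shows "\<phi> ` toggle e A = toggle (\<phi> e) (\<phi> ` A)"
proof -
  have "\<phi> e \<in> \<phi> ` A \<longleftrightarrow> e \<in> A" using assms by (simp add: inj_on_image_mem_iff)
  moreover have "\<phi> ` (A - {e}) = \<phi> ` A - {\<phi> e}"
    using inj_on_image_set_diff[OF assms(1), of A "{e}"] assms by auto
  ultimately show ?thesis by (auto simp: toggle_def)
qed

text \<open>\<open>boundary_count G A - 1\<close> is the least number of toggles that turn \<open>A\<close> into a spanning
  quasi-tree.\<close>

lemma boundary_count_image_le:
  assumes G: "one_vertex_gem G" and H: "one_vertex_gem H" and ne: "flags G \<noteq> {}" "flags H \<noteq> {}"
    and \<phi>: "bij_betw \<phi> (edges G) (edges H)"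
    and one: "\<And>A. A \<subseteq> edges G \<Longrightarrow> one_boundary G A \<Longrightarrow> one_boundary H (\<phi> ` A)"
    and "A \<subseteq> edges G"
  shows "boundary_count H (\<phi> ` A) \<le> boundary_count G A"
  using \<open>A \<subseteq> edges G\<close>
proof (induction "boundary_count G A" arbitrary: A rule: less_induct)
  case less
  note A = less.prems
  have \<phi>A: "\<phi> ` A \<subseteq> edges H" using A bij_betw_imp_surj_on[OF \<phi>] by blast
  show ?case
  proof (cases "boundary_count G A = 1")
    case True
    then have "one_boundary G A" using one_vertex_gem.one_boundary_iff_count[OF G A ne(1)] by simp
    then have "one_boundary H (\<phi> ` A)" by (rule one[OF A])
    then show ?thesis using one_vertex_gem.one_boundary_iff_count[OF H \<phi>A ne(2)] True by simp
  next
    case False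
    then have "boundary_count G A > 1" using one_vertex_gem.boundary_count_pos[OF G ne(1), of A] by simp
    then obtain e where e: "e \<in> edges G" and lt: "boundary_count G (toggle e A) < boundary_count G A"
      using one_vertex_gem.exists_toggle_decreasing[OF G A] by blast
    have \<phi>e: "\<phi> e \<in> edges H" using \<phi> e by (auto simp: bij_betw_def)
    \<comment> \<open>The toggle gains at least one in \<open>G\<close>, and its image costs at most
      one in \<open>H\<close>.\<close>
    have "boundary_count H (\<phi> ` A) \<le> boundary_count H (toggle (\<phi> e) (\<phi> ` A)) + 1"
      by (rule one_vertex_gem.boundary_count_toggle_le[OF H \<phi>A \<phi>e])
    also have "toggle (\<phi> e) (\<phi> ` A) = \<phi> ` toggle e A"
      using image_toggle[of \<phi> "edges G" A e] \<phi> A e by (simp add: bij_betw_def)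
    also have "boundary_count H (\<phi> ` toggle e A) \<le> boundary_count G (toggle e A)"
      by (rule less.hyps[OF lt one_vertex_gem.toggle_edges[OF G e A]])
    finally show ?thesis using lt by simp
  qed
qed

lemma bouquet_one_vertex_gem:
  assumes "is_bouquet B"
  shows "one_vertex_gem B"
proof
  show wf: "wf_gem B" using assms by (simp add: is_bouquet_def)
  fix x assume x: "x \<in> flags B"
  then have "card (orbits (flags B) {t1 B, t2 B}) = 1" using assms by (auto simp: is_bouquet_def vertices_def)
  moreover have "invols (flags B) {t1 B, t2 B}" using wf by (auto simp: wf_gem_def fpf_inv_def invols_def)
  ultimately show "orb (flags B) {t1 B, t2 B} x = flags B" using card_orbits_eq_1_iff x by metis
qed

text \<open>Treated apart because the empty gem has no component, so the genus formula for partial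
  duals does not cover it; the only term has genus 0.\<close>

lemma pd_poly_no_flags:
  assumes "flags B = {}"
  shows "pd_poly B = 1"
proof -
  have "edges B = {}" using assms by (simp add: edges_def orbits_def)
  then show ?thesis using assms
    by (simp add: pd_poly_def euler_genus_def partial_dual_def components_def vertices_def faces_def
        edges_def orbits_def)
qed

theorem mainTheorem4:
  fixes B :: "'f gem" and B' :: "'g gem" and \<phi> :: "'f set \<Rightarrow> 'g set"
  assumes "is_bouquet B" and "is_bouquet B'"
    and "bij_betw \<phi> (edges B) (edges B')"
    and "\<forall>u\<in>edges B. \<forall>v\<in>edges B. ig_adj (DM B) u v \<longleftrightarrow> ig_adj (DM B') (\<phi> u) (\<phi> v)"
    and "\<forall>v\<in>edges B. ig_loop (DM B) v \<longleftrightarrow> ig_loop (DM B') (\<phi> v)"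
  shows "pd_poly B = pd_poly B'"
proof -
  interpret B: one_vertex_gem B by (rule bouquet_one_vertex_gem[OF assms(1)])
  interpret B': one_vertex_gem B' by (rule bouquet_one_vertex_gem[OF assms(2)])
  let ?E = "edges B" and ?E' = "edges B'"
  have inj: "inj_on \<phi> ?E" and im: "\<phi> ` ?E = ?E'" using assms(3) by (auto simp: bij_betw_def)
  have "flags B = {} \<longleftrightarrow> ?E = {}" "flags B' = {} \<longleftrightarrow> ?E' = {}"
    by (auto simp: B.edges_eq B'.edges_eq)
  then have flags: "flags B = {} \<longleftrightarrow> flags B' = {}" using im by auto
  show ?thesis
  proof (cases "flags B = {}")
    case True
    then show ?thesis using flags by (simp add: pd_poly_no_flags)
  next
    case False
    then have ne: "flags B \<noteq> {}" "flags B' \<noteq> {}" using flags by auto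
    have fst: "fst (DM B) = ?E" "fst (DM B') = ?E'" by (simp_all add: DM_def)
    \<comment> \<open>Loops supply the diagonal entries and adjacency the off-diagonal ones.\<close>
    have interlace: "B'.interlace (\<phi> u) (\<phi> v) = B.interlace u v" if uv: "u \<in> ?E" "v \<in> ?E" for u v
    proof (cases "u = v")
      case True
      then show ?thesis using assms(5) uv im
        by (auto simp: ig_loop_def fst B.rep_matrix_DM B'.rep_matrix_DM)
    next
      case False
      then have "\<phi> u \<noteq> \<phi> v" using inj uv by (auto dest: inj_onD)
      then show ?thesis using assms(4) uv im False
        by (auto simp: ig_adj_def fst B.rep_matrix_DM B'.rep_matrix_DM)
    qed
    have one: "one_boundary B' (\<phi> ` A) = one_boundary B A" if A: "A \<subseteq> ?E" for A
    proof -
      have "nonsingular B'.interlace (\<phi> ` A) = nonsingular B.interlace A"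
        by (rule nonsingular_image) (use inj_on_subset[OF inj A] interlace A in auto)
      moreover have "\<phi> ` A \<subseteq> ?E'" using A im by auto
      ultimately show ?thesis
        using A B.nonsingular_iff_one_boundary B'.nonsingular_iff_one_boundary by simp
    qed
    have count: "boundary_count B' (\<phi> ` A) = boundary_count B A" if A: "A \<subseteq> ?E" for A
    proof (rule antisym)
      show "boundary_count B' (\<phi> ` A) \<le> boundary_count B A"
        by (rule boundary_count_image_le[OF B.one_vertex_gem_axioms B'.one_vertex_gem_axioms ne assms(3)])
          (use one A in auto)
      \<comment> \<open>The reverse inequality is the same bound for the inverse bijection.\<close>
      let ?\<psi> = "inv_into ?E \<phi>"
      have "boundary_count B (?\<psi> ` (\<phi> ` A)) \<le> boundary_count B' (\<phi> ` A)"
      proof (rule boundary_count_image_le[OF B'.one_vertex_gem_axioms B.one_vertex_gem_axioms ne(2,1)])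
        show "bij_betw ?\<psi> ?E' ?E" by (rule bij_betw_inv_into[OF assms(3)])
        show "\<phi> ` A \<subseteq> ?E'" using A im by auto
        fix A' assume A': "A' \<subseteq> ?E'" "one_boundary B' A'"
        have "\<phi> ` (?\<psi> ` A') = A'" using A'(1) im by (simp add: image_inv_into_cancel)
        moreover have "?\<psi> ` A' \<subseteq> ?E" using A'(1) im inv_into_into[of _ \<phi> ?E] by auto
        ultimately show "one_boundary B (?\<psi> ` A')" using one A'(2) by metis
      qed
      then show "boundary_count B A \<le> boundary_count B' (\<phi> ` A)"
        using inv_into_image_cancel[OF inj A] by simp
    qed
    have genus: "euler_genus (partial_dual B' (\<phi> ` A)) = euler_genus (partial_dual B A)" if A: "A \<subseteq> ?E" for A
    proof -
      have A': "\<phi> ` A \<subseteq> ?E'" using A im by auto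
      \<comment> \<open>The genus also involves the boundary count of the complement, so
        \<open>\<phi>\<close> has to respect complements.\<close>
      have compl: "?E' - \<phi> ` A = \<phi> ` (?E - A)"
        using inj_on_image_set_diff[OF inj, of ?E A] A im by auto
      show ?thesis
        unfolding B.euler_genus_partial_dual[OF A ne(1)] B'.euler_genus_partial_dual[OF A' ne(2)] compl
          count[OF A] count[OF Diff_subset] using bij_betw_same_card[OF assms(3)] by simp
    qed
    have "bij_betw ((`) \<phi>) (Pow ?E) (Pow ?E')" using assms(3) by (rule bij_betw_Pow)
    then have "pd_poly B' = (\<Sum>A\<in>Pow ?E. monom 1 (euler_genus (partial_dual B' (\<phi> ` A))))"
      unfolding pd_poly_def by (rule sum.reindex_bij_betw[symmetric])
    also have "\<dots> = pd_poly B"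
      unfolding pd_poly_def by (rule sum.cong) (use genus in auto)
    finally show ?thesis ..
  qed
qed

end
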